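(* Consider the federated model with finite client set $\mathcal{K}$ and joint distribution $p(k,\bm{x},y,\bm{z})=p(k)\,p(\bm{x},y|k)\,p(\bm{z}|k,\bm{x})$ of the client $K$, input $X$, class label $Y$ and representation $Z$. Let $q(\bm{z}|y)$ be a conditional distribution serving as an approximation of the global representation distribution $p(\bm{z}|y)$. Then the conditional mutual information between $Z$ and $K$ given $Y$ satisfies $$I(Z;K|Y)\le\mathcal{L}_{align},\qquad \mathcal{L}_{align}=\sum_{k\in\mathcal{K}}p(k)\,\mathbb{E}_{p(\bm{x},y|k)}\,D_{\mathrm{KL}}\big(p(\bm{z}|k,\bm{x})\,\|\,q(\bm{z}|y)\big),$$ where $D_{\mathrm{KL}}\big(p(\bm{z}|k,\bm{x})\,\|\,q(\bm{z}|y)\big)=\int p(\bm{z}|k,\bm{x})\log\frac{p(\bm{z}|k,\bm{x})}{q(\bm{z}|y)}\,d\bm{z}$ is the Kullback–Leibler divergence between the local and approximate global representation distributions.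
   Context: Each client $k\in\mathcal{K}$ has weight $p(k)$ (a probability distribution on $\mathcal{K}$) and data distribution $p(\bm{x},y|k)$ over inputs and class labels (finitely many classes). A probabilistic encoder maps an input $\bm{x}$ of client $k$ to a random representation $\bm{z}$ with distribution $p(\bm{z}|k,\bm{x})$, so that $\bm{z}$ is independent of $y$ given $(k,\bm{x})$. The distributions $p(k,y)$, $p(\bm{z}|k,y)$ and $p(\bm{z}|y)$ (the global representation distribution) are those induced by the joint distribution. The conditional mutual information is $I(Z;K|Y)=\sum_{k\in\mathcal{K}}\int_Y\int_Z p(k,y)\,p(\bm{z}|k,y)\log\frac{p(\bm{z}|k,y)}{p(\bm{z}|y)}\,d\bm{z}\,dy$, where the integral over the label $y$ is a sum over the classes. *)

theory Defs
  imports "HOL-Probability.Probability"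
begin

text \<open>
  Throughout, a conditional distribution of the representation is given by its density with respect
  to a reference measure \<open>R\<close> (the \<open>dz\<close> of the integrals), for example \<open>lborel\<close> or a counting measure.
\<close>

definition prob_density :: "'z measure \<Rightarrow> ('z \<Rightarrow> real) \<Rightarrow> bool" where
  "prob_density R f \<longleftrightarrow>
     f \<in> borel_measurable R \<and> (\<forall>z\<in>space R. 0 \<le> f z) \<and> (\<integral>\<^sup>+ z. ennreal (f z) \<partial>R) = 1"

text \<open>
  Integral with values in the extended reals: positive part minus negative part. The Bochner integral
  is unsuitable here, since it is \<open>0\<close> on functions that are not integrable, whereas divergences may
  be infinite.
\<close>

definition ext_integral :: "'a measure \<Rightarrow> ('a \<Rightarrow> ereal) \<Rightarrow> ereal" where
  "ext_integral M f =
     enn2ereal (\<integral>\<^sup>+ x. e2ennreal (f x) \<partial>M) - enn2ereal (\<integral>\<^sup>+ x. e2ennreal (- f x) \<partial>M)"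

lemma ext_integral_eq_integral:
  fixes f :: "'a \<Rightarrow> real"
  assumes "integrable M f"
  shows "ext_integral M (\<lambda>x. ereal (f x)) = ereal (integral\<^sup>L M f)"
proof -
  have fin: "(\<integral>\<^sup>+ x. ennreal (f x) \<partial>M) \<noteq> \<infinity>" "(\<integral>\<^sup>+ x. ennreal (- f x) \<partial>M) \<noteq> \<infinity>"
    using assms by (auto simp: real_integrable_def)
  have "enn2ereal u = ereal (enn2real u)" if "u \<noteq> \<infinity>" for u
    using that by (cases u) (auto simp: enn2ereal_ennreal)
  then show ?thesis
    unfolding ext_integral_def real_lebesgue_integral_def[OF assms]
    using fin by (simp add: ennreal.abs_eq[symmetric] e2ennreal_ereal)
qed

text \<open>The integrand \<open>a log (a / b)\<close>, with \<open>0 log (0 / b) = 0\<close> and \<open>a log (a / 0) = \<infinity>\<close> for \<open>a > 0\<close>.\<close>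

definition log_ratio_term :: "real \<Rightarrow> real \<Rightarrow> ereal" where
  "log_ratio_term a b =
     (if a = 0 then 0 else if b = 0 then \<infinity> else ereal (a * ln (a / b)))"

definition kl_div :: "'z measure \<Rightarrow> ('z \<Rightarrow> real) \<Rightarrow> ('z \<Rightarrow> real) \<Rightarrow> ereal" where
  "kl_div R f g = ext_integral R (\<lambda>z. log_ratio_term (f z) (g z))"

text \<open>
  \<open>p\<close> gives the client weights, \<open>D k\<close> the data distribution of client \<open>k\<close> on inputs and labels, and
  \<open>e k x\<close> the density of the encoder of client \<open>k\<close> at input \<open>x\<close>. The \<open>\<sigma>\<close>-algebra of the input space
  is that of \<open>S\<close>; the measure carried by \<open>S\<close> is irrelevant.
\<close>

definition federated_model ::
  "'x measure \<Rightarrow> 'z measure \<Rightarrow> ('k::finite \<Rightarrow> ('x \<times> 'y::finite) measure) \<Rightarrow>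
   ('k \<Rightarrow> 'x \<Rightarrow> 'z \<Rightarrow> real) \<Rightarrow> bool" where
  "federated_model S R D e \<longleftrightarrow>
     sigma_finite_measure R \<and>
     (\<forall>k. prob_space (D k) \<and> sets (D k) = sets (S \<Otimes>\<^sub>M count_space UNIV)) \<and>
     (\<forall>k. (\<lambda>(x, z). e k x z) \<in> borel_measurable (S \<Otimes>\<^sub>M R)) \<and>
     (\<forall>k. \<forall>x\<in>space S. prob_density R (e k x))"

definition joint ::
  "'x measure \<Rightarrow> 'z measure \<Rightarrow> 'k::finite pmf \<Rightarrow> ('k \<Rightarrow> ('x \<times> 'y::finite) measure) \<Rightarrow>
   ('k \<Rightarrow> 'x \<Rightarrow> 'z \<Rightarrow> real) \<Rightarrow> ('k \<times> 'x \<times> 'y \<times> 'z) measure" where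
  "joint S R p D e =
     measure_pmf p \<bind> (\<lambda>k. D k \<bind> (\<lambda>(x, y).
       distr (density R (\<lambda>z. ennreal (e k x z)))
         (count_space UNIV \<Otimes>\<^sub>M S \<Otimes>\<^sub>M count_space UNIV \<Otimes>\<^sub>M R) (\<lambda>z. (k, x, y, z))))"

definition client_label_event ::
  "('k \<times> 'x \<times> 'y \<times> 'z) measure \<Rightarrow> 'k \<Rightarrow> 'y \<Rightarrow> ('k \<times> 'x \<times> 'y \<times> 'z) set" where
  "client_label_event J k y = {(k', x, y', z) \<in> space J. k' = k \<and> y' = y}"

definition label_event ::
  "('k \<times> 'x \<times> 'y \<times> 'z) measure \<Rightarrow> 'y \<Rightarrow> ('k \<times> 'x \<times> 'y \<times> 'z) set" where
  "label_event J y = {(k, x, y', z) \<in> space J. y' = y}"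

text \<open>
  Density of the representation under the joint distribution \<open>J\<close> conditioned on the event \<open>A\<close>. It is
  meaningful when \<open>A\<close> has positive probability, and then determined up to null sets of \<open>R\<close>.
\<close>

definition repr_density ::
  "'z measure \<Rightarrow> ('k \<times> 'x \<times> 'y \<times> 'z) measure \<Rightarrow> ('k \<times> 'x \<times> 'y \<times> 'z) set \<Rightarrow> 'z \<Rightarrow> real" where
  "repr_density R J A z =
     enn2real (RN_deriv R (distr (uniform_measure J A) R (\<lambda>(k, x, y, z). z)) z)"

text \<open>
  \<open>I(Z; K | Y)\<close>. Pairs \<open>(k, y)\<close> of probability \<open>0\<close> contribute \<open>0\<close>, as \<open>0 * \<infinity> = 0\<close> in \<open>ereal\<close>.
\<close>

definition cond_mutual_info ::
  "'z measure \<Rightarrow> ('k::finite \<times> 'x \<times> 'y::finite \<times> 'z) measure \<Rightarrow> ereal" where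
  "cond_mutual_info R J =
     (\<Sum>k\<in>UNIV. \<Sum>y\<in>UNIV. ext_integral R (\<lambda>z.
        ereal (measure J (client_label_event J k y)) *
        log_ratio_term (repr_density R J (client_label_event J k y) z)
          (repr_density R J (label_event J y) z)))"

definition align_loss ::
  "'z measure \<Rightarrow> 'k::finite pmf \<Rightarrow> ('k \<Rightarrow> ('x \<times> 'y::finite) measure) \<Rightarrow>
   ('k \<Rightarrow> 'x \<Rightarrow> 'z \<Rightarrow> real) \<Rightarrow> ('y \<Rightarrow> 'z \<Rightarrow> real) \<Rightarrow> ereal" where
  "align_loss R p D e q =
     (\<Sum>k\<in>UNIV. ereal (pmf p k) * ext_integral (D k) (\<lambda>(x, y). kl_div R (e k x) (q y)))"

end

theory Submission
  imports Defs
begin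

text \<open>
  Up to terms that integrate to \<open>0\<close>, the Kullback-Leibler integrand \<open>a log (a / b)\<close> of two probability
  densities is the nonnegative Bregman divergence \<open>a log (a / b) - a + b\<close>, so both sides of the
  inequality become integrals of nonnegative functions and can be compared pointwise in \<open>z\<close> and label
  by label. Since \<open>p(z|y)\<close> is the mean of the \<open>p(z|k,y)\<close> with weights \<open>p(k,y)\<close>, replacing \<open>p(z|y)\<close> by
  any other reference value \<open>q(z|y)\<close> only increases the weighted sum of the divergences. Since
  \<open>p(z|k,y)\<close> is the mean of \<open>p(z|k,x)\<close> over the inputs \<open>x\<close> of client \<open>k\<close> with label \<open>y\<close>, convexity in the
  first argument bounds the result by the alignment loss.
\<close>

section \<open>Pointwise properties of the Bregman integrand\<close>

text \<open>Taking values in \<open>ennreal\<close> lets infinite divergences take part in sums and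
  integrals. For \<open>0 \<le> a\<close> and \<open>0 < b\<close> the real expression is
  nonnegative, so \<open>ennreal\<close> truncates nothing; for \<open>a = 0\<close> the logarithmic
  term vanishes and the value is \<open>b\<close>.\<close>

definition entropy_gap :: "real \<Rightarrow> real \<Rightarrow> ennreal" where
  "entropy_gap a b = (if b = 0 \<and> a \<noteq> 0 then \<infinity> else ennreal (a * ln (a / b) - a + b))"

lemma measurable_entropy_gap [measurable]:
  assumes [measurable]: "f \<in> borel_measurable M" "g \<in> borel_measurable M"
  shows "(\<lambda>x. entropy_gap (f x) (g x)) \<in> borel_measurable M"
  unfolding entropy_gap_def by measurable

lemma measurable_log_ratio_term [measurable]:
  assumes [measurable]: "f \<in> borel_measurable M" "g \<in> borel_measurable M"
  shows "(\<lambda>x. log_ratio_term (f x) (g x)) \<in> borel_measurable M"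
  unfolding log_ratio_term_def by measurable

text \<open>This is \<open>ln t \<le> t - 1\<close> at \<open>t = b * exp s / a\<close>, multiplied
  by \<open>a\<close>. It yields a family of minorants affine in \<open>a\<close>, one for each
  slope \<open>s\<close>; for \<open>0 < a\<close> equality holds at
  \<open>s = ln (a / b)\<close>.\<close>

lemma mult_ln_ratio_ge:
  fixes a b s :: real
  assumes "0 \<le> a" "0 < b"
  shows "a * s - b * (exp s - 1) \<le> a * ln (a / b) - a + b"
proof (cases "a = 0")
  case True
  then show ?thesis using assms by (simp add: algebra_simps)
next
  case False
  then have a: "0 < a" using assms by simp
  have "ln (b * exp s / a) \<le> b * exp s / a - 1"
    using a assms by (intro ln_le_minus_one) simp
  then have "a * ln (b * exp s / a) \<le> b * exp s - a"
    using a by (simp add: field_simps)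
  moreover have "ln (b * exp s / a) = s - ln (a / b)"
    using a assms by (simp add: ln_div ln_mult)
  ultimately show ?thesis by (simp add: algebra_simps)
qed

lemma mult_ln_ratio_nonneg:
  fixes a b :: real
  assumes "0 \<le> a" "0 < b"
  shows "0 \<le> a * ln (a / b) - a + b"
  using mult_ln_ratio_ge[OF assms, of 0] by simp

lemma entropy_gap_ge:
  assumes "0 \<le> a" "0 \<le> b"
  shows "ennreal (a * s - b * (exp s - 1)) \<le> entropy_gap a b"
  using mult_ln_ratio_ge[of a b s] assms
  by (cases "b = 0") (auto simp: entropy_gap_def intro!: ennreal_leI)

text \<open>
  The positive and negative parts are moved to opposite sides, so that the identity also holds when the
  value is \<open>\<infinity>\<close> and can be integrated without subtraction.
\<close>

lemma log_ratio_term_parts: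
  assumes a: "0 \<le> a" and b: "0 \<le> b" and c: "0 \<le> c"
  shows "e2ennreal (ereal c * log_ratio_term a b) + ennreal (c * b) =
    ennreal c * entropy_gap a b + e2ennreal (- (ereal c * log_ratio_term a b)) + ennreal (c * a)"
    and "e2ennreal (- (ereal c * log_ratio_term a b)) \<le> ennreal (c * b)"
proof -
  \<comment> \<open>The first three cases are the conventions for zero weight, for
    \<open>0 log (0 / b)\<close> and for \<open>a log (a / 0)\<close>; only the last one involves
    finite logarithms.\<close>
  consider "c = 0" | "a = 0" | "0 < c" "0 < a" "b = 0" | "0 < c" "0 < a" "0 < b"
    using assms by fastforce
  then have "e2ennreal (ereal c * log_ratio_term a b) + ennreal (c * b) =
    ennreal c * entropy_gap a b + e2ennreal (- (ereal c * log_ratio_term a b)) + ennreal (c * a)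
    \<and> e2ennreal (- (ereal c * log_ratio_term a b)) \<le> ennreal (c * b)"
  proof cases
    case 4
    let ?t = "c * (a * ln (a / b))"
    have gap: "0 \<le> a * ln (a / b) - a + b"
      using mult_ln_ratio_nonneg a 4 by blast
    then have "0 \<le> c * (a * ln (a / b) - a + b)" using c by simp
    then have ge: "0 \<le> ?t - c * a + c * b" by (simp add: algebra_simps)
    have pos: "0 \<le> c * a" "0 \<le> c * b" using assms by simp_all
    have val: "ereal c * log_ratio_term a b = ereal ?t"
      using 4 by (simp add: log_ratio_term_def)
    have gap_eq: "ennreal c * entropy_gap a b = ennreal (?t - c * a + c * b)"
      using 4 gap by (simp add: entropy_gap_def flip: ennreal_mult) (simp add: algebra_simps)
    have "ennreal ?t + ennreal (c * b) =
      ennreal (?t - c * a + c * b) + ennreal (- ?t) + ennreal (c * a)"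
    \<comment> \<open>Of the positive and the negative part of \<open>?t\<close> at least one is 0,
      and the identity becomes one between nonnegative reals.\<close>
    proof (cases "0 \<le> ?t")
      case True
      then have "ennreal (- ?t) = 0" by (intro ennreal_neg) simp
      then show ?thesis using True ge pos by (simp flip: ennreal_plus)
    next
      case False
      then have "ennreal ?t = 0" by (intro ennreal_neg) simp
      then show ?thesis using False ge pos by (simp flip: ennreal_plus)
    qed
    moreover have "ennreal (- ?t) \<le> ennreal (c * b)"
      using ge pos by (intro ennreal_leI) simp
    ultimately show ?thesis by (simp add: val gap_eq e2ennreal_ereal)
  qed (use assms in \<open>auto simp: log_ratio_term_def entropy_gap_def ennreal_mult ennreal_mult_top
        zero_ennreal_def[symmetric] e2ennreal_neg infinity_ennreal_def\<close>)
  then show "e2ennreal (ereal c * log_ratio_term a b) + ennreal (c * b) =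
    ennreal c * entropy_gap a b + e2ennreal (- (ereal c * log_ratio_term a b)) + ennreal (c * a)"
    and "e2ennreal (- (ereal c * log_ratio_term a b)) \<le> ennreal (c * b)"
    by blast+
qed

section \<open>Divergences as integrals of the nonnegative integrand\<close>

text \<open>Both \<open>c * f\<close> and \<open>c * g\<close> integrate to \<open>c\<close>, so
  integrating \<open>log_ratio_term_parts\<close> gives \<open>P + c = G + N + c\<close> for the
  integrals \<open>P\<close> and \<open>N\<close> of the positive and the negative part. Since
  \<open>N \<le> c\<close> is finite, \<open>P - N\<close> is never a difference of two infinities
  and equals \<open>G\<close>.\<close>

lemma ext_integral_log_ratio_term:
  assumes f: "prob_density R f" and g: "prob_density R g" and c: "0 \<le> c"
  shows "ext_integral R (\<lambda>z. ereal c * log_ratio_term (f z) (g z)) =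
    enn2ereal (ennreal c * (\<integral>\<^sup>+ z. entropy_gap (f z) (g z) \<partial>R))"
proof -
  have [measurable]: "f \<in> borel_measurable R" "g \<in> borel_measurable R"
    using f g by (auto simp: prob_density_def)
  have nonneg: "0 \<le> f z" "0 \<le> g z" if "z \<in> space R" for z
    using f g that by (auto simp: prob_density_def)
  have mass: "(\<integral>\<^sup>+ z. ennreal (c * f z) \<partial>R) = ennreal c" "(\<integral>\<^sup>+ z. ennreal (c * g z) \<partial>R) = ennreal c"
    using f g c by (simp_all add: prob_density_def ennreal_mult' nn_integral_cmult)
  define P where "P = (\<integral>\<^sup>+ z. e2ennreal (ereal c * log_ratio_term (f z) (g z)) \<partial>R)"
  define N where "N = (\<integral>\<^sup>+ z. e2ennreal (- (ereal c * log_ratio_term (f z) (g z))) \<partial>R)"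
  define G where "G = ennreal c * (\<integral>\<^sup>+ z. entropy_gap (f z) (g z) \<partial>R)"
  have "N \<le> (\<integral>\<^sup>+ z. ennreal (c * g z) \<partial>R)"
    unfolding N_def using nonneg c by (intro nn_integral_mono log_ratio_term_parts)
  then have N: "N \<noteq> \<infinity>" using mass by (auto simp: top_unique)
  have "P + ennreal c =
      (\<integral>\<^sup>+ z. e2ennreal (ereal c * log_ratio_term (f z) (g z)) + ennreal (c * g z) \<partial>R)"
    unfolding P_def by (subst nn_integral_add) (simp_all add: mass)
  also have "\<dots> = (\<integral>\<^sup>+ z. ennreal c * entropy_gap (f z) (g z)
      + e2ennreal (- (ereal c * log_ratio_term (f z) (g z))) + ennreal (c * f z) \<partial>R)"
    using nonneg c by (intro nn_integral_cong log_ratio_term_parts)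
  also have "\<dots> = G + N + ennreal c"
    unfolding G_def N_def by (simp add: nn_integral_add nn_integral_cmult mass)
  finally have "P = G + N"
    by (metis add.commute ennreal_add_left_cancel ennreal_neq_top infinity_ennreal_def)
  then have "enn2ereal P - enn2ereal N = enn2ereal G"
    using N by (cases G; cases N) (auto simp: plus_ennreal.rep_eq enn2ereal_ennreal)
  then show ?thesis by (simp add: ext_integral_def P_def N_def G_def)
qed

lemma kl_div_eq_nn_integral:
  assumes "prob_density R f" "prob_density R g"
  shows "kl_div R f g = enn2ereal (\<integral>\<^sup>+ z. entropy_gap (f z) (g z) \<partial>R)"
  using ext_integral_log_ratio_term[OF assms, of 1]
  by (simp add: kl_div_def flip: one_ereal_def)

section \<open>Jensen's inequality and optimality of the mean\<close>

text \<open>The right side is the integral of the positive part alone; the left side also subtracts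
  that of the negative part. This allows affine minorants that change sign.\<close>

lemma integral_le_nn_integral:
  fixes f :: "'a \<Rightarrow> real"
  assumes f: "integrable M f"
  shows "ennreal (integral\<^sup>L M f) \<le> (\<integral>\<^sup>+ x. ennreal (f x) \<partial>M)"
proof -
  have "(\<integral>\<^sup>+ x. ennreal (f x) \<partial>M) \<noteq> \<infinity>" using f by (auto simp: real_integrable_def)
  then have "(\<integral>\<^sup>+ x. ennreal (f x) \<partial>M) = ennreal (enn2real (\<integral>\<^sup>+ x. ennreal (f x) \<partial>M))"
    by (simp add: less_top)
  then show ?thesis
    unfolding real_lebesgue_integral_def[OF f]
    by (metis diff_le_eq ennreal_leI enn2real_nonneg le_add_same_cancel1)
qed

text \<open>Jensen's inequality for the convex first argument, with respect to a measure of total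
  mass \<open>w\<close> under which \<open>f\<close> has mean \<open>m\<close>. Keeping
  \<open>w\<close> as a factor covers the null measure too. Integrating affine minorants works even
  when the right side is infinite.\<close>

lemma entropy_gap_integral_le:
  assumes [measurable]: "f \<in> borel_measurable M"
    and f: "\<And>x. x \<in> space M \<Longrightarrow> 0 \<le> f x"
    and w: "emeasure M (space M) = ennreal w" "0 \<le> w"
    and m: "(\<integral>\<^sup>+ x. ennreal (f x) \<partial>M) = ennreal (w * m)" "0 \<le> m"
    and b: "0 \<le> b"
  shows "ennreal w * entropy_gap m b \<le> (\<integral>\<^sup>+ x. entropy_gap (f x) b \<partial>M)"
proof (cases "w = 0")
  case False
  then have w_pos: "0 < w" using w by simp
  interpret finite_measure M by standard (simp add: w)
  have meas: "measure M (space M) = w" using w by (simp add: measure_def)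
  have int: "integrable M f"
    using f m by (intro integrableI_nonneg) auto
  have int_eq: "integral\<^sup>L M f = w * m"
    using f m w by (subst integral_eq_nn_integral) auto
  \<comment> \<open>\<open>entropy_gap\<close> is the supremum over \<open>s\<close> of the affine bounds in \<open>entropy_gap_ge\<close>.\<close>
  have affine: "ennreal (w * (m * s - b * (exp s - 1))) \<le> (\<integral>\<^sup>+ x. entropy_gap (f x) b \<partial>M)" for s
  proof -
    have "ennreal (w * (m * s - b * (exp s - 1))) = ennreal (\<integral>x. f x * s - b * (exp s - 1) \<partial>M)"
      using int by (simp add: int_eq meas algebra_simps)
    also have "\<dots> \<le> (\<integral>\<^sup>+ x. ennreal (f x * s - b * (exp s - 1)) \<partial>M)"
      using int by (intro integral_le_nn_integral) simp
    also have "\<dots> \<le> (\<integral>\<^sup>+ x. entropy_gap (f x) b \<partial>M)"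
      using f b by (intro nn_integral_mono entropy_gap_ge)
    finally show ?thesis .
  qed
  consider "m = 0" | "0 < m" "b = 0" | "0 < m" "0 < b" using m b by fastforce
  then show ?thesis
  proof cases
    \<comment> \<open>With mean 0 the function vanishes almost everywhere, and both sides equal
      \<open>w * b\<close>.\<close>
    case 1
    then have "AE x in M. ennreal (f x) = 0"
      using m by (subst nn_integral_0_iff_AE[symmetric]) simp_all
    then have "AE x in M. entropy_gap (f x) b = ennreal b"
      using AE_space by eventually_elim (use f in \<open>fastforce simp: entropy_gap_def ennreal_eq_0_iff\<close>)
    then have "(\<integral>\<^sup>+ x. entropy_gap (f x) b \<partial>M) = (\<integral>\<^sup>+ x. ennreal b \<partial>M)"
      by (intro nn_integral_cong_AE)
    then show ?thesis using 1 w by (simp add: entropy_gap_def mult.commute)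
  next
    case 2
    have "(\<integral>\<^sup>+ x. entropy_gap (f x) b \<partial>M) = \<infinity>"
    proof (rule ccontr)
      assume "(\<integral>\<^sup>+ x. entropy_gap (f x) b \<partial>M) \<noteq> \<infinity>"
      then obtain r where r: "0 \<le> r" "(\<integral>\<^sup>+ x. entropy_gap (f x) b \<partial>M) = ennreal r"
        by (cases "\<integral>\<^sup>+ x. entropy_gap (f x) b \<partial>M") auto
      \<comment> \<open>For \<open>b = 0\<close> the affine bound is \<open>w * m * s\<close>,
        unbounded in \<open>s\<close>; the chosen slope makes it \<open>r + 1\<close>.\<close>
      then show False
        using affine[of "(r + 1) / (w * m)"] 2 w_pos by simp
    qed
    then show ?thesis by simp
  next
    case 3
    have "ennreal w * entropy_gap m b = ennreal (w * (m * ln (m / b) - m + b))"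
      using 3 w mult_ln_ratio_nonneg[of m b] by (simp add: entropy_gap_def ennreal_mult)
    \<comment> \<open>The minorant with slope \<open>s = ln (m / b)\<close> touches the function at
      \<open>m\<close>.\<close>
    also have "m * ln (m / b) - m + b = m * ln (m / b) - b * (exp (ln (m / b)) - 1)"
      using 3 by (simp add: field_simps)
    finally show ?thesis using affine by simp
  qed
qed simp

text \<open>For positive \<open>m\<close> and \<open>b\<close> the right side exceeds the left by
  exactly \<open>sum w I * (m * ln (m / b) - m + b)\<close>, the weighted divergence from the mean
  to \<open>b\<close>, which is nonnegative.\<close>

lemma entropy_gap_mean_le:
  assumes "finite I"
    and w: "\<And>i. i \<in> I \<Longrightarrow> 0 \<le> w i" "0 < sum w I"
    and a: "\<And>i. i \<in> I \<Longrightarrow> 0 \<le> a i"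
    and m: "sum w I * m = (\<Sum>i\<in>I. w i * a i)"
    and b: "0 \<le> b"
  shows "(\<Sum>i\<in>I. ennreal (w i) * entropy_gap (a i) m) \<le> (\<Sum>i\<in>I. ennreal (w i) * entropy_gap (a i) b)"
proof -
  have "0 \<le> (\<Sum>i\<in>I. w i * a i)" using w a by (intro sum_nonneg) simp
  then have m_nonneg: "0 \<le> m" using m w by (metis zero_le_mult_iff not_less)
  consider "m = 0" | "0 < m" "b = 0" | "0 < m" "0 < b" using m_nonneg b by fastforce
  then show ?thesis
  proof cases
    case 1
    then have "\<forall>i\<in>I. w i * a i = 0"
      using m w a \<open>finite I\<close> by (subst sum_nonneg_eq_0_iff[symmetric]) auto
    then show ?thesis
      using 1 w by (intro sum_mono) (auto simp: entropy_gap_def)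
  next
    case 2
    \<comment> \<open>A positive mean forces some index with \<open>w i * a i\<close> nonzero; with
      \<open>b = 0\<close> its term alone makes the right side infinite.\<close>
    then have "(\<Sum>i\<in>I. w i * a i) \<noteq> 0" using m w by (metis less_irrefl mult_pos_pos)
    then obtain i where i: "i \<in> I" "w i * a i \<noteq> 0" by (meson sum.neutral)
    then have "0 < w i" using w(1)[of i] by auto
    then have "ennreal (w i) * entropy_gap (a i) b = \<infinity>"
      using 2 i by (auto simp: entropy_gap_def ennreal_mult_eq_top_iff ennreal_eq_0_iff)
    then have "(\<Sum>i\<in>I. ennreal (w i) * entropy_gap (a i) b) = \<infinity>"
      using member_le_sum[OF i(1), of "\<lambda>i. ennreal (w i) * entropy_gap (a i) b"] \<open>finite I\<close>
      by (simp add: top_unique)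
    then show ?thesis by simp
  next
    case 3
    have gap_sum: "(\<Sum>i\<in>I. ennreal (w i) * entropy_gap (a i) t) =
        ennreal (\<Sum>i\<in>I. w i * (a i * ln (a i / t) - a i + t))" if "0 < t" for t
      using that w a mult_ln_ratio_nonneg
      by (subst sum_ennreal[symmetric])
         (auto simp: entropy_gap_def ennreal_mult simp del: sum_ennreal intro!: sum.cong)
    \<comment> \<open>The terms \<open>a i * ln (a i)\<close> cancel. What remains is affine in
      \<open>a i\<close>, so its weighted sum depends only on the mean.\<close>
    have "w i * (a i * ln (a i / b) - a i + b) - w i * (a i * ln (a i / m) - a i + m) =
        w i * a i * ln (m / b) + w i * (b - m)" if "i \<in> I" for i
      using 3 a[OF that] by (cases "a i = 0") (auto simp: ln_div algebra_simps)
    then have "(\<Sum>i\<in>I. w i * (a i * ln (a i / b) - a i + b)) -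
        (\<Sum>i\<in>I. w i * (a i * ln (a i / m) - a i + m)) =
        (\<Sum>i\<in>I. w i * a i) * ln (m / b) + sum w I * (b - m)"
      by (simp add: sum.distrib sum_distrib_right flip: sum_subtractf)
    also have "\<dots> = sum w I * (m * ln (m / b) - m + b)"
      by (simp only: m[symmetric]) (simp add: algebra_simps)
    also have "\<dots> \<ge> 0" using mult_ln_ratio_nonneg 3 w by simp
    finally show ?thesis using 3 by (auto simp: gap_sum intro!: ennreal_leI)
  qed
qed

lemma enn2ereal_sum: "enn2ereal (sum f I) = (\<Sum>i\<in>I. enn2ereal (f i))"
  by (induction I rule: infinite_finite_induct) (simp_all add: plus_ennreal.rep_eq zero_ennreal.rep_eq)

section \<open>The joint distribution as an iterated mixture\<close>

locale federated =
  fixes S :: "'x measure" and R :: "'z measure"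
    and p :: "'k::finite pmf" and D :: "'k \<Rightarrow> ('x \<times> 'y::finite) measure"
    and e :: "'k \<Rightarrow> 'x \<Rightarrow> 'z \<Rightarrow> real"
  assumes model: "federated_model S R D e"
begin

sublocale R: sigma_finite_measure R
  using model by (simp add: federated_model_def)

lemma prob_space_D: "prob_space (D k)"
  and sets_D [measurable_cong]: "sets (D k) = sets (S \<Otimes>\<^sub>M count_space UNIV)"
  and measurable_e: "(\<lambda>(x, z). e k x z) \<in> borel_measurable (S \<Otimes>\<^sub>M R)"
  and prob_density_e: "x \<in> space S \<Longrightarrow> prob_density R (e k x)"
  using model by (auto simp: federated_model_def)

lemma space_D: "space (D k) = space S \<times> UNIV"
  using sets_eq_imp_space_eq[OF sets_D] by (simp add: space_pair_measure)

lemma measurable_e_compose [measurable (raw)]: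
  assumes [measurable]: "f \<in> measurable M S" "g \<in> measurable M R"
  shows "(\<lambda>v. e k (f v) (g v)) \<in> borel_measurable M"
  using measurable_compose[OF measurable_Pair[OF assms] measurable_e[of k]] by simp

lemma e_nonneg: "x \<in> space S \<Longrightarrow> z \<in> space R \<Longrightarrow> 0 \<le> e k x z"
  using prob_density_e by (auto simp: prob_density_def)

lemma nn_integral_e: "x \<in> space S \<Longrightarrow> (\<integral>\<^sup>+ z. ennreal (e k x z) \<partial>R) = 1"
  using prob_density_e by (auto simp: prob_density_def)

abbreviation N :: "('k \<times> 'x \<times> 'y \<times> 'z) measure" where
  "N \<equiv> count_space UNIV \<Otimes>\<^sub>M S \<Otimes>\<^sub>M count_space UNIV \<Otimes>\<^sub>M R"

abbreviation J :: "('k \<times> 'x \<times> 'y \<times> 'z) measure" where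
  "J \<equiv> joint S R p D e"

definition encoder_kernel :: "'k \<Rightarrow> 'x \<times> 'y \<Rightarrow> ('k \<times> 'x \<times> 'y \<times> 'z) measure" where
  "encoder_kernel k = (\<lambda>(x, y). distr (density R (\<lambda>z. ennreal (e k x z))) N (\<lambda>z. (k, x, y, z)))"

lemma emeasure_encoder_kernel:
  assumes [measurable]: "A \<in> sets N" and v: "v \<in> space (D k)"
  shows "emeasure (encoder_kernel k v) A =
    (\<integral>\<^sup>+ z. ennreal (e k (fst v) z) * indicator A (k, fst v, snd v, z) \<partial>R)"
proof -
  have [measurable]: "fst v \<in> space S" using v by (auto simp: space_D)
  have [measurable]: "(\<lambda>z. (k, fst v, snd v, z)) \<in> measurable R N" by measurable
  have "emeasure (encoder_kernel k v) A =
      (\<integral>\<^sup>+ z. ennreal (e k (fst v) z) * indicator ((\<lambda>z. (k, fst v, snd v, z)) -` A \<inter> space R) z \<partial>R)"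
    by (simp add: encoder_kernel_def case_prod_beta emeasure_distr emeasure_density)
  also have "\<dots> = (\<integral>\<^sup>+ z. ennreal (e k (fst v) z) * indicator A (k, fst v, snd v, z) \<partial>R)"
    by (intro nn_integral_cong) (auto simp: indicator_def)
  finally show ?thesis .
qed

lemma prob_space_encoder_kernel:
  assumes v: "v \<in> space (D k)"
  shows "prob_space (encoder_kernel k v)"
proof -
  have x [measurable]: "fst v \<in> space S" using v by (auto simp: space_D)
  have "prob_space (density R (\<lambda>z. ennreal (e k (fst v) z)))"
    by standard (simp add: emeasure_density nn_integral_e[OF x] cong: nn_integral_cong)
  then show ?thesis
    unfolding encoder_kernel_def case_prod_beta by (rule prob_space.prob_space_distr) measurable
qed

text \<open>The integral formula for \<open>bind\<close> requires a kernel measurable into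
  \<open>subprob_algebra\<close>. Measurability in \<open>v\<close> is read off the explicit
  integral in \<open>emeasure_encoder_kernel\<close>.\<close>

lemma measurable_encoder_kernel: "encoder_kernel k \<in> measurable (D k) (subprob_algebra N)"
proof (rule measurable_subprob_algebra)
  fix v assume v: "v \<in> space (D k)"
  then show "subprob_space (encoder_kernel k v)"
    by (intro prob_space_imp_subprob_space prob_space_encoder_kernel)
  show "sets (encoder_kernel k v) = sets N" by (simp add: encoder_kernel_def case_prod_beta)
next
  fix A assume [measurable]: "A \<in> sets N"
  have "(\<lambda>v. \<integral>\<^sup>+ z. ennreal (e k (fst v) z) * indicator A (k, fst v, snd v, z) \<partial>R)
      \<in> borel_measurable (D k)"
    by measurable
  then show "(\<lambda>v. emeasure (encoder_kernel k v) A) \<in> borel_measurable (D k)"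
    by (subst measurable_cong[OF emeasure_encoder_kernel]) simp_all
qed

lemma space_D_not_empty: "space (D k) \<noteq> {}"
  using prob_space.not_empty[OF prob_space_D] .

lemma prob_space_bind_encoder_kernel: "prob_space (D k \<bind> encoder_kernel k)"
  using prob_space_D
  by (rule prob_space.prob_space_bind[where S = N])
     (auto intro: prob_space_encoder_kernel measurable_encoder_kernel)

lemma joint_eq: "J = measure_pmf p \<bind> (\<lambda>k. D k \<bind> encoder_kernel k)"
  by (simp add: joint_def encoder_kernel_def)

lemma measurable_bind_encoder_kernel:
  "(\<lambda>k. D k \<bind> encoder_kernel k) \<in> measurable (measure_pmf p) (subprob_algebra N)"
  by (auto simp: space_subprob_algebra intro!: prob_space_imp_subprob_space prob_space_bind_encoder_kernel
      sets_bind[OF sets_kernel[OF measurable_encoder_kernel] space_D_not_empty])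

lemma sets_joint [measurable_cong]: "sets J = sets N"
  unfolding joint_eq by (rule sets_bind[OF sets_kernel[OF measurable_bind_encoder_kernel]]) auto

lemma space_joint: "space J = UNIV \<times> space S \<times> UNIV \<times> space R"
  using sets_eq_imp_space_eq[OF sets_joint] by (simp add: space_pair_measure)

text \<open>Both binds unfold, the outer one into a finite sum. All later probabilities under
  \<open>J\<close> are computed from this formula.\<close>

lemma emeasure_joint:
  assumes "A \<in> sets N"
  shows "emeasure J A = (\<Sum>k\<in>UNIV. ennreal (pmf p k) *
    (\<integral>\<^sup>+ v. \<integral>\<^sup>+ z. ennreal (e k (fst v) z) * indicator A (k, fst v, snd v, z) \<partial>R \<partial>D k))"
proof -
  have "emeasure J A = (\<integral>\<^sup>+ k. emeasure (D k \<bind> encoder_kernel k) A \<partial>measure_pmf p)"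
    unfolding joint_eq by (rule emeasure_bind[OF _ measurable_bind_encoder_kernel assms]) simp
  also have "\<dots> = (\<Sum>k\<in>UNIV. ennreal (pmf p k) * emeasure (D k \<bind> encoder_kernel k) A)"
    by (simp add: nn_integral_measure_pmf nn_integral_count_space_finite)
  also have "\<dots> = (\<Sum>k\<in>UNIV. ennreal (pmf p k) * (\<integral>\<^sup>+ v. emeasure (encoder_kernel k v) A \<partial>D k))"
    using emeasure_bind[OF space_D_not_empty measurable_encoder_kernel assms] by simp
  also have "\<dots> = (\<Sum>k\<in>UNIV. ennreal (pmf p k) *
      (\<integral>\<^sup>+ v. \<integral>\<^sup>+ z. ennreal (e k (fst v) z) * indicator A (k, fst v, snd v, z) \<partial>R \<partial>D k))"
    using emeasure_encoder_kernel[OF assms] by (simp cong: nn_integral_cong)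
  finally show ?thesis .
qed

section \<open>Splitting the data by client and label\<close>

text \<open>
  \<open>cell k y\<close> is the part of the data distribution with client \<open>k\<close> and label \<open>y\<close>, so that \<open>mass k y\<close> is
  \<open>p(k,y)\<close> and \<open>repr k y z\<close> is the unnormalised density \<open>p(k,y) p(z|k,y)\<close>.
\<close>

definition cell :: "'k \<Rightarrow> 'y \<Rightarrow> ('x \<times> 'y) measure" where
  "cell k y = density (D k) (\<lambda>v. ennreal (pmf p k) * indicator {y} (snd v))"

definition mass :: "'k \<Rightarrow> 'y \<Rightarrow> real" where
  "mass k y = measure (cell k y) (space (cell k y))"

definition repr :: "'k \<Rightarrow> 'y \<Rightarrow> 'z \<Rightarrow> ennreal" where
  "repr k y z = (\<integral>\<^sup>+ v. ennreal (e k (fst v) z) \<partial>cell k y)"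

lemma sets_cell [measurable_cong]: "sets (cell k y) = sets (S \<Otimes>\<^sub>M count_space UNIV)"
  by (simp add: cell_def sets_D)

lemma space_cell: "space (cell k y) = space S \<times> UNIV"
  by (simp add: cell_def space_D)

text \<open>The cells of client \<open>k\<close> partition \<open>D k\<close>, scaled by the client
  weight, according to the label. The integrand may depend on the label: at \<open>v\<close> only
  the summand with \<open>y = snd v\<close> survives.\<close>

lemma sum_nn_integral_cell:
  assumes [measurable]: "\<And>y. F y \<in> borel_measurable (D k)"
  shows "(\<Sum>y\<in>UNIV. \<integral>\<^sup>+ v. F y v \<partial>cell k y) = ennreal (pmf p k) * (\<integral>\<^sup>+ v. F (snd v) v \<partial>D k)"
proof -
  have eq: "F (snd v) v = (\<Sum>y\<in>UNIV. indicator {y} (snd v) * F y v)" for v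
    by (subst sum.remove[of _ "snd v"]) (auto intro!: sum.neutral)
  have "(\<Sum>y\<in>UNIV. \<integral>\<^sup>+ v. F y v \<partial>cell k y) =
      (\<Sum>y\<in>UNIV. ennreal (pmf p k) * (\<integral>\<^sup>+ v. indicator {y} (snd v) * F y v \<partial>D k))"
    unfolding cell_def by (simp add: nn_integral_density mult.assoc nn_integral_cmult)
  also have "\<dots> = ennreal (pmf p k) * (\<integral>\<^sup>+ v. (\<Sum>y\<in>UNIV. indicator {y} (snd v) * F y v) \<partial>D k)"
    by (subst nn_integral_sum) (simp_all add: sum_distrib_left)
  finally show ?thesis by (simp only: eq[symmetric])
qed

lemma finite_measure_cell: "finite_measure (cell k y)"
proof
  interpret prob_space "D k" by (rule prob_space_D)
  have "emeasure (cell k y) (space (cell k y)) =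
      (\<integral>\<^sup>+ v. ennreal (pmf p k) * indicator {y} (snd v) * indicator (space (D k)) v \<partial>D k)"
    unfolding cell_def by (subst emeasure_density) auto
  also have "\<dots> \<le> (\<integral>\<^sup>+ v. ennreal (pmf p k) \<partial>D k)"
    by (intro nn_integral_mono) (auto split: split_indicator)
  also have "\<dots> < \<infinity>" by (simp add: emeasure_space_1)
  finally show "emeasure (cell k y) (space (cell k y)) \<noteq> \<infinity>" by simp
qed

lemma emeasure_cell: "emeasure (cell k y) (space (cell k y)) = ennreal (mass k y)"
  unfolding mass_def by (rule finite_measure.emeasure_eq_measure[OF finite_measure_cell])

lemma mass_nonneg: "0 \<le> mass k y"
  by (simp add: mass_def)

lemma measurable_repr [measurable]: "repr k y \<in> borel_measurable R"
proof -
  interpret finite_measure "cell k y" by (rule finite_measure_cell)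
  show ?thesis unfolding repr_def[abs_def] by measurable
qed

lemma nn_integral_cell_commute:
  assumes [measurable]: "case_prod F \<in> borel_measurable (cell k y \<Otimes>\<^sub>M R)"
  shows "(\<integral>\<^sup>+ v. \<integral>\<^sup>+ z. F v z \<partial>R \<partial>cell k y) = (\<integral>\<^sup>+ z. \<integral>\<^sup>+ v. F v z \<partial>cell k y \<partial>R)"
proof -
  interpret finite_measure "cell k y" by (rule finite_measure_cell)
  interpret pair_sigma_finite "cell k y" R ..
  show ?thesis by (rule Fubini'[symmetric]) measurable
qed

text \<open>After exchanging the integrals, every encoder density contributes 1, which leaves the
  total mass of the cell.\<close>

lemma nn_integral_repr: "(\<integral>\<^sup>+ z. repr k y z \<partial>R) = ennreal (mass k y)"
proof -
  have "(\<integral>\<^sup>+ z. repr k y z \<partial>R) = (\<integral>\<^sup>+ v. \<integral>\<^sup>+ z. ennreal (e k (fst v) z) \<partial>R \<partial>cell k y)"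
    unfolding repr_def by (rule nn_integral_cell_commute[symmetric]) measurable
  also have "\<dots> = (\<integral>\<^sup>+ v. 1 \<partial>cell k y)"
    by (intro nn_integral_cong nn_integral_e) (auto simp: space_cell)
  finally show ?thesis by (simp add: emeasure_cell)
qed

lemma repr_finite: "AE z in R. repr k y z \<noteq> \<infinity>"
  by (rule nn_integral_noteq_infinite) (simp_all add: nn_integral_repr)

section \<open>Conditional densities of the representation\<close>

text \<open>A common form of \<open>client_label_event\<close> and \<open>label_event\<close>, so
  that \<open>p(z|k,y)\<close> and \<open>p(z|y)\<close> come from one computation.\<close>

definition event :: "('k \<times> 'y) set \<Rightarrow> ('k \<times> 'x \<times> 'y \<times> 'z) set" where
  "event C = {(k, x, y, z) \<in> space J. (k, y) \<in> C}"

lemma client_label_event_eq: "client_label_event J k y = event {(k, y)}"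
  by (auto simp: client_label_event_def event_def)

lemma label_event_eq: "label_event J y = event (UNIV \<times> {y})"
  by (auto simp: label_event_def event_def)

lemma measurable_event_repr:
  assumes [measurable]: "B \<in> sets R"
  shows "{(k, x, y, z) \<in> space J. (k, y) \<in> C \<and> z \<in> B} \<in> sets N"
proof -
  have "{(k, x, y, z) \<in> space J. (k, y) \<in> C \<and> z \<in> B} =
      (\<Union>(k, y)\<in>C. {k} \<times> space S \<times> {y} \<times> B)"
    using sets.sets_into_space[OF assms] by (auto simp: space_joint)
  also have "\<dots> \<in> sets N"
    by (intro sets.finite_UN) auto
  finally show ?thesis .
qed

lemma measurable_event [measurable]: "event C \<in> sets J"
  using measurable_event_repr[OF sets.top, of C]
  by (auto simp: event_def sets_joint space_joint elim!: back_subst[of "\<lambda>A. A \<in> sets N"])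

text \<open>Membership in \<open>C\<close> depends only on client and label, so it is constant on
  each cell. Splitting \<open>D k\<close> into cells and exchanging the integrals by Tonelli leaves
  the sum of the \<open>repr k y\<close> as the density in \<open>z\<close>.\<close>

lemma emeasure_event_repr:
  assumes [measurable]: "B \<in> sets R"
  shows "emeasure J {(k, x, y, z) \<in> space J. (k, y) \<in> C \<and> z \<in> B} =
    (\<integral>\<^sup>+ z. (\<Sum>(k, y)\<in>C. repr k y z) * indicator B z \<partial>R)"
proof -
  let ?c = "\<lambda>k y. indicator C (k, y) :: ennreal"
  have "emeasure J {(k, x, y, z) \<in> space J. (k, y) \<in> C \<and> z \<in> B} =
    (\<Sum>k\<in>UNIV. ennreal (pmf p k) * (\<integral>\<^sup>+ v. \<integral>\<^sup>+ z. ennreal (e k (fst v) z) *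
       indicator {(k, x, y, z) \<in> space J. (k, y) \<in> C \<and> z \<in> B} (k, fst v, snd v, z) \<partial>R \<partial>D k))"
    by (rule emeasure_joint[OF measurable_event_repr[OF assms]])
  also have "\<dots> = (\<Sum>k\<in>UNIV. ennreal (pmf p k) * (\<integral>\<^sup>+ v. \<integral>\<^sup>+ z. ?c k (snd v) *
       (ennreal (e k (fst v) z) * indicator B z) \<partial>R \<partial>D k))"
  proof -
    have "indicator {(k, x, y, z) \<in> space J. (k, y) \<in> C \<and> z \<in> B} (k, fst v, snd v, z) =
        ?c k (snd v) * indicator B z" if "v \<in> space (D k)" "z \<in> space R" for k v z
      using that by (auto simp: space_joint space_D split: split_indicator)
    then show ?thesis
      by (simp add: mult.left_commute cong: nn_integral_cong)
  qed
  also have "\<dots> = (\<Sum>k\<in>UNIV. \<Sum>y\<in>UNIV. \<integral>\<^sup>+ v. \<integral>\<^sup>+ z. ?c k y *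
       (ennreal (e k (fst v) z) * indicator B z) \<partial>R \<partial>cell k y)"
    by (subst sum_nn_integral_cell) simp_all
  also have "\<dots> = (\<Sum>k\<in>UNIV. \<Sum>y\<in>UNIV. \<integral>\<^sup>+ z. \<integral>\<^sup>+ v. ?c k y *
       (ennreal (e k (fst v) z) * indicator B z) \<partial>cell k y \<partial>R)"
    by (subst nn_integral_cell_commute) simp_all
  also have "\<dots> = (\<Sum>k\<in>UNIV. \<Sum>y\<in>UNIV. \<integral>\<^sup>+ z. ?c k y * (repr k y z * indicator B z) \<partial>R)"
    unfolding repr_def
    by (intro sum.cong refl nn_integral_cong)
       (simp add: nn_integral_cmult nn_integral_multc)
  also have "\<dots> = (\<integral>\<^sup>+ z. (\<Sum>k\<in>UNIV. \<Sum>y\<in>UNIV. ?c k y * (repr k y z * indicator B z)) \<partial>R)"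
    by (simp add: nn_integral_sum del: sum_mult_indicator sum_indicator_mult)
  also have "\<dots> = (\<integral>\<^sup>+ z. (\<Sum>(k, y)\<in>C. repr k y z) * indicator B z \<partial>R)"
  proof (rule nn_integral_cong)
    fix z
    have "(\<Sum>k\<in>UNIV. \<Sum>y\<in>UNIV. ?c k y * (repr k y z * indicator B z)) =
        (\<Sum>u\<in>UNIV. indicator C u * (case u of (k, y) \<Rightarrow> repr k y z * indicator B z))"
      by (subst sum.cartesian_product) (intro sum.cong, auto)
    also have "\<dots> = (\<Sum>(k, y)\<in>C. repr k y z * indicator B z)"
      by (subst sum_indicator_mult) simp_all
    finally show "(\<Sum>k\<in>UNIV. \<Sum>y\<in>UNIV. ?c k y * (repr k y z * indicator B z)) =
        (\<Sum>(k, y)\<in>C. repr k y z) * indicator B z"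
      by (simp add: sum_distrib_right case_prod_beta)
  qed
  finally show ?thesis .
qed

lemma emeasure_event: "emeasure J (event C) = ennreal (\<Sum>(k, y)\<in>C. mass k y)"
proof -
  have "event C = {(k, x, y, z) \<in> space J. (k, y) \<in> C \<and> z \<in> space R}"
    by (auto simp: event_def space_joint)
  then have "emeasure J (event C) = (\<integral>\<^sup>+ z. (\<Sum>(k, y)\<in>C. repr k y z) * indicator (space R) z \<partial>R)"
    using emeasure_event_repr[OF sets.top, of C] by simp
  also have "\<dots> = (\<integral>\<^sup>+ z. (\<Sum>(k, y)\<in>C. repr k y z) \<partial>R)"
    by (intro nn_integral_cong) simp
  also have "\<dots> = (\<Sum>(k, y)\<in>C. ennreal (mass k y))"
    by (simp add: case_prod_beta nn_integral_sum nn_integral_repr)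
  finally show ?thesis
    by (simp add: case_prod_beta sum_ennreal mass_nonneg)
qed

lemma measure_event: "measure J (event C) = (\<Sum>(k, y)\<in>C. mass k y)"
  by (simp add: measure_def emeasure_event sum_nonneg mass_nonneg case_prod_beta)

text \<open>By \<open>emeasure_event_repr\<close> the conditional law of the representation has
  density \<open>h / c\<close>, and a Radon-Nikodym derivative is unique almost everywhere.
  Positivity of \<open>c\<close> makes the conditioning meaningful.\<close>

lemma repr_density_event:
  assumes pos: "0 < (\<Sum>(k, y)\<in>C. mass k y)"
  shows "AE z in R. repr_density R J (event C) z =
      enn2real (\<Sum>(k, y)\<in>C. repr k y z) / (\<Sum>(k, y)\<in>C. mass k y)"
    and "prob_density R (repr_density R J (event C))"
proof -
  define c where "c = (\<Sum>(k, y)\<in>C. mass k y)"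
  define h where "h = (\<lambda>z. (\<Sum>(k, y)\<in>C. repr k y z))"
  have c: "0 < c" using pos by (simp add: c_def)
  have [measurable]: "h \<in> borel_measurable R"
    by (simp add: h_def case_prod_beta)
  define Q where "Q = distr (uniform_measure J (event C)) R (\<lambda>(k, x, y, z). z)"
  have proj: "(\<lambda>(k, x, y, z). z) \<in> measurable (uniform_measure J (event C)) R"
  proof -
    have "(\<lambda>(k, x, y, z). z) \<in> measurable N R" by measurable
    then show ?thesis by (simp cong: measurable_cong_sets add: sets_joint)
  qed
  have "density R (\<lambda>z. h z / ennreal c) = Q"
  proof (rule measure_eqI)
    show "sets (density R (\<lambda>z. h z / ennreal c)) = sets Q" by (simp add: Q_def)
    fix B assume "B \<in> sets (density R (\<lambda>z. h z / ennreal c))"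
    then have B [measurable]: "B \<in> sets R" by simp
    have vimage: "(\<lambda>(k, x, y, z). z) -` B \<inter> space J =
        {(k, x, y, z) \<in> space J. z \<in> B}" (is "_ = ?V")
      by auto
    have "?V \<in> sets J"
      using measurable_event_repr[OF B, of UNIV] by (simp add: sets_joint)
    then have "emeasure Q B = emeasure J (event C \<inter> ?V) / ennreal c"
      unfolding Q_def
      by (simp add: emeasure_distr[OF proj B] vimage emeasure_uniform_measure emeasure_event c_def)
    also have "event C \<inter> ?V = {(k, x, y, z) \<in> space J. (k, y) \<in> C \<and> z \<in> B}"
      by (auto simp: event_def)
    also have "emeasure J \<dots> = (\<integral>\<^sup>+ z. h z * indicator B z \<partial>R)"
      unfolding h_def by (rule emeasure_event_repr[OF B])
    also have "\<dots> / ennreal c = (\<integral>\<^sup>+ z. (h z / ennreal c) * indicator B z \<partial>R)"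
      by (subst nn_integral_divide[symmetric]) (simp_all add: divide_ennreal_def ac_simps)
    also have "\<dots> = emeasure (density R (\<lambda>z. h z / ennreal c)) B"
      by (simp add: emeasure_density)
    finally show "emeasure (density R (\<lambda>z. h z / ennreal c)) B = emeasure Q B" by simp
  qed
  then have "AE z in R. h z / ennreal c = RN_deriv R Q z"
    by (intro R.RN_deriv_unique) simp_all
  then have AE: "AE z in R. repr_density R J (event C) z = enn2real (h z) / c"
  proof eventually_elim
    case (elim z)
    have "repr_density R J (event C) z = enn2real (h z / ennreal c)"
      by (simp add: repr_density_def elim flip: Q_def)
    \<comment> \<open>Where \<open>h z\<close> is infinite, both sides are 0 because
      \<open>enn2real\<close> sends infinity to 0.\<close>
    also have "\<dots> = enn2real (h z) / c"
      using c by (cases "h z") (auto simp: divide_ennreal ennreal_top_divide)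
    finally show ?case .
  qed
  then show "AE z in R. repr_density R J (event C) z =
      enn2real (\<Sum>(k, y)\<in>C. repr k y z) / (\<Sum>(k, y)\<in>C. mass k y)"
    by (simp add: h_def c_def)
  have int_h: "(\<integral>\<^sup>+ z. h z \<partial>R) = ennreal c"
    by (simp add: h_def c_def case_prod_beta nn_integral_sum nn_integral_repr sum_ennreal mass_nonneg)
  \<comment> \<open>Going back from reals to \<open>ennreal\<close> fails where \<open>h\<close> is
    infinite; that set is null because \<open>h\<close> has finite integral.\<close>
  then have "AE z in R. h z \<noteq> \<infinity>"
    by (intro nn_integral_noteq_infinite) simp_all
  with AE have "AE z in R. ennreal (repr_density R J (event C) z) = h z / ennreal c"
  proof eventually_elim
    case (elim z)
    then show ?case using c by (cases "h z") (auto simp: divide_ennreal)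
  qed
  then have "(\<integral>\<^sup>+ z. ennreal (repr_density R J (event C) z) \<partial>R) = (\<integral>\<^sup>+ z. h z / ennreal c \<partial>R)"
    by (rule nn_integral_cong_AE)
  also have "\<dots> = 1"
    using c by (simp add: nn_integral_divide int_h divide_ennreal)
  finally show "prob_density R (repr_density R J (event C))"
    by (simp add: prob_density_def repr_density_def[abs_def])
qed

lemma sum_label: "(\<Sum>(k, y')\<in>UNIV \<times> {y}. f k y') = (\<Sum>k\<in>UNIV. f k y)"
  by (simp flip: sum.cartesian_product)

section \<open>Client and global representation densities\<close>

definition client_density :: "'k \<Rightarrow> 'y \<Rightarrow> 'z \<Rightarrow> real" where
  "client_density k y = repr_density R J (client_label_event J k y)"

definition global_density :: "'y \<Rightarrow> 'z \<Rightarrow> real" where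
  "global_density y = repr_density R J (label_event J y)"

lemma measurable_densities [measurable]:
  "client_density k y \<in> borel_measurable R" "global_density y \<in> borel_measurable R"
  by (simp_all add: client_density_def global_density_def repr_density_def[abs_def])

lemma densities_nonneg: "0 \<le> client_density k y z" "0 \<le> global_density y z"
  by (simp_all add: client_density_def global_density_def repr_density_def)

text \<open>For \<open>mass k y = 0\<close> the conditional density carries no meaning, but the
  factor removes it, and \<open>repr k y\<close> vanishes almost everywhere because its integral is
  0.\<close>

lemma repr_eq: "AE z in R. repr k y z = ennreal (mass k y * client_density k y z)"
proof (cases "mass k y = 0")
  case True
  then have "AE z in R. repr k y z = 0"
    using nn_integral_repr[of k y] by (subst nn_integral_0_iff_AE[symmetric]) simp_all
  then show ?thesis using True by simp
next
  case False
  then have pos: "0 < mass k y" using mass_nonneg[of k y] by simp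
  then have "AE z in R. client_density k y z = enn2real (repr k y z) / mass k y"
    using repr_density_event(1)[of "{(k, y)}"] by (simp add: client_density_def client_label_event_eq)
  then show ?thesis
    using repr_finite[of k y]
    by eventually_elim (use pos in \<open>simp add: less_top\<close>)
qed

text \<open>The law of total probability \<open>p(y) p(z|y) = \<Sum>k. p(k,y) p(z|k,y)\<close>: it
  exhibits the global density as the weighted mean that \<open>entropy_gap_mean_le\<close>
  requires.\<close>

lemma global_density_eq:
  assumes "0 < (\<Sum>k\<in>UNIV. mass k y)"
  shows "AE z in R. (\<Sum>k\<in>UNIV. mass k y) * global_density y z =
    (\<Sum>k\<in>UNIV. mass k y * client_density k y z)"
proof -
  have "AE z in R. global_density y z = enn2real (\<Sum>k\<in>UNIV. repr k y z) / (\<Sum>k\<in>UNIV. mass k y)"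
    using repr_density_event(1)[of "UNIV \<times> {y}"] assms
    by (simp add: global_density_def label_event_eq sum_label)
  moreover have "AE z in R. \<forall>k. repr k y z = ennreal (mass k y * client_density k y z)"
    using repr_eq by (simp add: AE_all_countable)
  ultimately show ?thesis
  proof eventually_elim
    case (elim z)
    have "(\<Sum>k\<in>UNIV. repr k y z) = ennreal (\<Sum>k\<in>UNIV. mass k y * client_density k y z)"
      using elim by (simp add: sum_ennreal mass_nonneg densities_nonneg)
    then have "enn2real (\<Sum>k\<in>UNIV. repr k y z) = (\<Sum>k\<in>UNIV. mass k y * client_density k y z)"
      by (simp add: sum_nonneg mass_nonneg densities_nonneg)
    then show ?case using elim assms by simp
  qed
qed

section \<open>Comparison of mutual information and alignment loss\<close>

lemma cond_mutual_info_eq: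
  "cond_mutual_info R J = enn2ereal (\<Sum>k\<in>UNIV. \<Sum>y\<in>UNIV. ennreal (mass k y) *
     (\<integral>\<^sup>+ z. entropy_gap (client_density k y z) (global_density y z) \<partial>R))"
proof -
  have "ext_integral R (\<lambda>z. ereal (measure J (client_label_event J k y)) *
        log_ratio_term (repr_density R J (client_label_event J k y) z)
          (repr_density R J (label_event J y) z)) =
      enn2ereal (ennreal (mass k y) *
        (\<integral>\<^sup>+ z. entropy_gap (client_density k y z) (global_density y z) \<partial>R))" for k y
  proof (cases "mass k y = 0")
    case True
    then show ?thesis
      by (simp add: client_label_event_eq measure_event ext_integral_def zero_ennreal.rep_eq
          flip: zero_ereal_def)
  next
    case False
    then have pos: "0 < mass k y" using mass_nonneg[of k y] by simp
    \<comment> \<open>Since \<open>p(y)\<close> is at least \<open>p(k,y) > 0\<close>, conditioning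
      on the label alone is meaningful as well, and both arguments are probability
      densities.\<close>
    also have "mass k y \<le> (\<Sum>k\<in>UNIV. mass k y)"
      by (intro member_le_sum) (simp_all add: mass_nonneg)
    finally have "prob_density R (global_density y)"
      using repr_density_event(2)[of "UNIV \<times> {y}"]
      by (simp add: global_density_def label_event_eq sum_label)
    moreover have "prob_density R (client_density k y)"
      using repr_density_event(2)[of "{(k, y)}"] pos
      by (simp add: client_density_def client_label_event_eq)
    ultimately have "ext_integral R (\<lambda>z. ereal (mass k y) *
        log_ratio_term (client_density k y z) (global_density y z)) =
      enn2ereal (ennreal (mass k y) *
        (\<integral>\<^sup>+ z. entropy_gap (client_density k y z) (global_density y z) \<partial>R))"
      by (intro ext_integral_log_ratio_term) (simp_all add: mass_nonneg)
    then show ?thesis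
      by (simp add: client_density_def global_density_def client_label_event_eq measure_event)
  qed
  then show ?thesis by (simp only: cond_mutual_info_def enn2ereal_sum)
qed

text \<open>Each divergence is nonnegative, so the negative part in \<open>ext_integral\<close> is
  0. Splitting into cells and exchanging integrals moves \<open>z\<close> outermost, ready for a
  comparison at fixed \<open>z\<close>.\<close>

lemma align_loss_eq:
  assumes q: "\<And>y. prob_density R (q y)"
  shows "align_loss R p D e q = enn2ereal (\<Sum>k\<in>UNIV. \<Sum>y\<in>UNIV.
    \<integral>\<^sup>+ z. \<integral>\<^sup>+ v. entropy_gap (e k (fst v) z) (q y z) \<partial>cell k y \<partial>R)"
proof -
  have [measurable]: "q y \<in> borel_measurable R" for y
    using q by (simp add: prob_density_def)
  let ?G = "\<lambda>k y v. \<integral>\<^sup>+ z. entropy_gap (e k (fst v) z) (q y z) \<partial>R"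
  have "ext_integral (D k) (\<lambda>(x, y). kl_div R (e k x) (q y)) =
      enn2ereal (\<integral>\<^sup>+ v. ?G k (snd v) v \<partial>D k)" for k
  proof -
    have kl: "kl_div R (e k (fst v)) (q (snd v)) = enn2ereal (?G k (snd v) v)" if "v \<in> space (D k)" for v
      using that q by (intro kl_div_eq_nn_integral prob_density_e) (auto simp: space_D)
    have "(\<integral>\<^sup>+ v. e2ennreal (kl_div R (e k (fst v)) (q (snd v))) \<partial>D k) = (\<integral>\<^sup>+ v. ?G k (snd v) v \<partial>D k)"
      by (intro nn_integral_cong) (simp add: kl)
    moreover have "(\<integral>\<^sup>+ v. e2ennreal (- kl_div R (e k (fst v)) (q (snd v))) \<partial>D k) = (\<integral>\<^sup>+ v. 0 \<partial>D k)"
      by (intro nn_integral_cong) (simp add: kl e2ennreal_neg)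
    ultimately show ?thesis by (simp add: ext_integral_def case_prod_beta zero_ennreal.rep_eq)
  qed
  then have "align_loss R p D e q =
      enn2ereal (\<Sum>k\<in>UNIV. ennreal (pmf p k) * (\<integral>\<^sup>+ v. ?G k (snd v) v \<partial>D k))"
    by (simp add: align_loss_def enn2ereal_sum times_ennreal.rep_eq enn2ereal_ennreal)
  also have "\<dots> = enn2ereal (\<Sum>k\<in>UNIV. \<Sum>y\<in>UNIV. \<integral>\<^sup>+ v. ?G k y v \<partial>cell k y)"
    by (subst sum_nn_integral_cell) simp_all
  also have "\<dots> = enn2ereal (\<Sum>k\<in>UNIV. \<Sum>y\<in>UNIV.
      \<integral>\<^sup>+ z. \<integral>\<^sup>+ v. entropy_gap (e k (fst v) z) (q y z) \<partial>cell k y \<partial>R)"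
    by (subst nn_integral_cell_commute) simp_all
  finally show ?thesis .
qed

lemma cond_mutual_info_le_align_loss:
  assumes q: "\<And>y. prob_density R (q y)"
  shows "cond_mutual_info R J \<le> align_loss R p D e q"
proof -
  interpret cell: finite_measure "cell k y" for k y by (rule finite_measure_cell)
  have [measurable]: "q y \<in> borel_measurable R" for y
    using q by (simp add: prob_density_def)
  have "(\<Sum>k\<in>UNIV. ennreal (mass k y) *
        (\<integral>\<^sup>+ z. entropy_gap (client_density k y z) (global_density y z) \<partial>R)) \<le>
      (\<Sum>k\<in>UNIV. \<integral>\<^sup>+ z. \<integral>\<^sup>+ v. entropy_gap (e k (fst v) z) (q y z) \<partial>cell k y \<partial>R)" for y
  proof (cases "0 < (\<Sum>k\<in>UNIV. mass k y)")
    case False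
    \<comment> \<open>For a label of probability 0 all weights vanish, so the left side is 0
      whatever the densities are.\<close>
    then have "\<forall>k. mass k y = 0"
      using sum_nonneg[of UNIV "\<lambda>k. mass k y"] sum_nonneg_eq_0_iff[of UNIV "\<lambda>k. mass k y"]
      by (simp add: mass_nonneg)
    then show ?thesis by simp
  next
    case True
    have "AE z in R. \<forall>k. repr k y z = ennreal (mass k y * client_density k y z)"
      using repr_eq by (simp add: AE_all_countable)
    with global_density_eq[OF True] AE_space[of R]
    have pointwise: "AE z in R.
        (\<Sum>k\<in>UNIV. ennreal (mass k y) * entropy_gap (client_density k y z) (global_density y z)) \<le>
        (\<Sum>k\<in>UNIV. \<integral>\<^sup>+ v. entropy_gap (e k (fst v) z) (q y z) \<partial>cell k y)"
    proof eventually_elim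
      case (elim z)
      have q_nonneg: "0 \<le> q y z" using q elim by (auto simp: prob_density_def)
      have [measurable]: "z \<in> space R" by (fact elim)
      \<comment> \<open>At this \<open>z\<close> the global density is the weighted mean of the
        client densities, hence a reference value at least as good as \<open>q y z\<close>.\<close>
      have "(\<Sum>k\<in>UNIV. ennreal (mass k y) * entropy_gap (client_density k y z) (global_density y z)) \<le>
          (\<Sum>k\<in>UNIV. ennreal (mass k y) * entropy_gap (client_density k y z) (q y z))"
        using True elim q_nonneg
        by (intro entropy_gap_mean_le) (simp_all add: mass_nonneg densities_nonneg)
      \<comment> \<open>Jensen on each cell: its total mass is \<open>mass k y\<close>, and by
        \<open>repr_eq\<close> the mean of the encoder densities at \<open>z\<close> is
        \<open>client_density k y z\<close>.\<close>
      also have "\<dots> \<le> (\<Sum>k\<in>UNIV. \<integral>\<^sup>+ v. entropy_gap (e k (fst v) z) (q y z) \<partial>cell k y)"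
      proof (rule sum_mono, rule entropy_gap_integral_le)
        fix k
        show "(\<lambda>v. e k (fst v) z) \<in> borel_measurable (cell k y)" by measurable
        show "(\<integral>\<^sup>+ v. ennreal (e k (fst v) z) \<partial>cell k y) =
            ennreal (mass k y * client_density k y z)"
          using elim by (simp add: repr_def)
      qed (use elim q_nonneg in
          \<open>auto simp: emeasure_cell[unfolded space_cell] mass_nonneg densities_nonneg
            space_cell intro!: e_nonneg\<close>)
      finally show ?case .
    qed
    have "(\<Sum>k\<in>UNIV. ennreal (mass k y) *
          (\<integral>\<^sup>+ z. entropy_gap (client_density k y z) (global_density y z) \<partial>R)) =
        (\<integral>\<^sup>+ z. (\<Sum>k\<in>UNIV. ennreal (mass k y) *
          entropy_gap (client_density k y z) (global_density y z)) \<partial>R)"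
      by (simp add: nn_integral_sum nn_integral_cmult)
    also have "\<dots> \<le> (\<integral>\<^sup>+ z. (\<Sum>k\<in>UNIV. \<integral>\<^sup>+ v. entropy_gap (e k (fst v) z) (q y z) \<partial>cell k y) \<partial>R)"
      by (rule nn_integral_mono_AE[OF pointwise])
    also have "\<dots> = (\<Sum>k\<in>UNIV. \<integral>\<^sup>+ z. \<integral>\<^sup>+ v. entropy_gap (e k (fst v) z) (q y z) \<partial>cell k y \<partial>R)"
      by (rule nn_integral_sum) measurable
    finally show ?thesis .
  qed
  then show ?thesis
    unfolding cond_mutual_info_eq align_loss_eq[OF q] less_eq_ennreal.rep_eq[symmetric]
    \<comment> \<open>The bound holds label by label after summing over clients, so the label sum is
      moved outermost on both sides.\<close>
    by (subst (1 2) sum.swap) (rule sum_mono)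
qed

end

theorem proposition3:
  fixes S :: "'x measure" and R :: "'z measure"
    and p :: "'k::finite pmf" and D :: "'k \<Rightarrow> ('x \<times> 'y::finite) measure"
    and e :: "'k \<Rightarrow> 'x \<Rightarrow> 'z \<Rightarrow> real" and q :: "'y \<Rightarrow> 'z \<Rightarrow> real"
  assumes "federated_model S R D e"
    and "\<And>y. prob_density R (q y)"
  shows "cond_mutual_info R (joint S R p D e) \<le> align_loss R p D e q"
proof -
  interpret federated S R p D e by standard (fact assms(1))
  show ?thesis by (rule cond_mutual_info_le_align_loss[OF assms(2)])
qed

end
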